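(* Let $V$ be a vector space of finite dimension $n\geq 2$ over $\mathbb{F}_q$ and let $\mathcal{M}$ be an $\mathbb{F}_q$-subspace of $\mathrm{Symm}(V)$. Let $r$ and $\ell$ be integers of opposite parity with $0<r<\ell\leq n$. Suppose that the rank of any non-zero element of $\mathcal{M}$ is $r$ or $\ell$. Then, provided that $q\neq 2$, we have $\dim\mathcal{M}\leq 2n-r$.
   Context: $q$ is a power of a prime and $\mathbb{F}_q$ is the field of order $q$. $\mathrm{Symm}(V)$ denotes the $\mathbb{F}_q$-vector space of all symmetric bilinear forms $f:V\times V\to\mathbb{F}_q$. The radical of $f$ is $\mathrm{rad} f=\{u\in V: f(u,v)=0\text{ for all }v\in V\}$ and $\mathrm{rank} f=\dim V-\dim\mathrm{rad} f$. *)

theory Defs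
  imports Complex_Main "HOL-Library.Function_Algebras" "HOL-Library.Cardinality"
begin

text \<open>
  A vector space \<open>V\<close> over a field is a type \<open>'v\<close> with a scalar multiplication \<open>scale\<close> satisfying
  the locale \<open>vector_space\<close>. Forms on \<open>V\<close> are plain functions \<open>'v \<Rightarrow> 'v \<Rightarrow> 'k\<close>; their addition and
  zero are the pointwise ones of \<open>Function_Algebras\<close>.
\<close>

definition form_scale :: "'k::field \<Rightarrow> ('v \<Rightarrow> 'v \<Rightarrow> 'k) \<Rightarrow> ('v \<Rightarrow> 'v \<Rightarrow> 'k)"
  where "form_scale c f = (\<lambda>u v. c * f u v)"

definition bilinear_form :: "('k::field \<Rightarrow> 'v::ab_group_add \<Rightarrow> 'v) \<Rightarrow> ('v \<Rightarrow> 'v \<Rightarrow> 'k) \<Rightarrow> bool"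
  where "bilinear_form scale f \<longleftrightarrow>
    (\<forall>u. Vector_Spaces.linear scale (*) (\<lambda>v. f u v)) \<and>
    (\<forall>v. Vector_Spaces.linear scale (*) (\<lambda>u. f u v))"

definition Symm :: "('k::field \<Rightarrow> 'v::ab_group_add \<Rightarrow> 'v) \<Rightarrow> ('v \<Rightarrow> 'v \<Rightarrow> 'k) set"
  where "Symm scale = {f. bilinear_form scale f \<and> (\<forall>u v. f u v = f v u)}"

definition radical :: "('v \<Rightarrow> 'v \<Rightarrow> 'k::zero) \<Rightarrow> 'v set"
  where "radical f = {u. \<forall>v. f u v = 0}"

definition form_rank :: "('k::field \<Rightarrow> 'v::ab_group_add \<Rightarrow> 'v) \<Rightarrow> ('v \<Rightarrow> 'v \<Rightarrow> 'k) \<Rightarrow> nat"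
  where "form_rank scale f =
    vector_space.dim scale (UNIV :: 'v set) - vector_space.dim scale (radical f)"

lemma vector_space_form_scale:
  "vector_space (form_scale :: 'k::field \<Rightarrow> ('v \<Rightarrow> 'v \<Rightarrow> 'k) \<Rightarrow> 'v \<Rightarrow> 'v \<Rightarrow> 'k)"
  by unfold_locales (simp_all add: form_scale_def fun_eq_iff algebra_simps)

lemma subspace_Symm:
  assumes "vector_space scale"
  shows "module.subspace form_scale (Symm scale)"
proof -
  interpret V: vector_space scale by (fact assms)
  interpret F: vector_space "form_scale :: 'a \<Rightarrow> ('b \<Rightarrow> 'b \<Rightarrow> 'a) \<Rightarrow> 'b \<Rightarrow> 'b \<Rightarrow> 'a"
    by (fact vector_space_form_scale)
  interpret K: vector_space "(*) :: 'a \<Rightarrow> 'a \<Rightarrow> 'a"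
    by unfold_locales (simp_all add: algebra_simps)
  interpret P: vector_space_pair scale "(*) :: 'a \<Rightarrow> 'a \<Rightarrow> 'a" ..
  show ?thesis
    unfolding F.subspace_def Symm_def bilinear_form_def form_scale_def
    by (auto intro!: P.linear_zero P.linear_compose_add P.linear_compose_scale_right
        simp: zero_fun_def plus_fun_def)
qed

end

theory Submission
  imports Defs
begin

text \<open>
  Let \<open>q\<close> be the order of the field \<open>k\<close>, \<open>n = dim V\<close> and \<open>d = dim M\<close>.  The proof is a divisibility
  argument that counts the zeros of the forms in \<open>M\<close> in two ways.

  Take points \<open>z\<close> at which every \<open>f \<in> M\<close> has a value that is linear in \<open>f\<close>.  At each point either all of
  \<open>M\<close> vanishes or exactly a \<open>q\<close>-th part of it does.  If \<open>f\<close> has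
  \<open>(|Z| + (q - 1) w f) / q\<close> zeros in a finite set \<open>Z\<close> of points, so that \<open>w f\<close> measures the excess over the
  expected number \<open>|Z| / q\<close>, then summing over \<open>M\<close> shows that \<open>|M| = q ^ d\<close> divides the sum of the \<open>w f\<close>
  (lemma \<open>card_dvd_weight_sum\<close>).  Two evaluations at the pairs \<open>(x, y) \<in> V \<times> V\<close> are used:

  \<^item> the value \<open>f x y\<close>, for which \<open>w f = q ^ (2n - rank f)\<close> (lemma \<open>bilinear_zeros\<close>);

  \<^item> the value \<open>f x x + f x y + \<delta> f y y\<close>, where \<open>X\<^sup>2 + X + \<delta>\<close> has no root in \<open>k\<close>.  This is the value at
    \<open>x + \<omega> y\<close> of the Hermitian form that extends \<open>f\<close> to the quadratic extension \<open>k(\<omega>)\<close>, where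
    \<open>\<omega>\<^sup>2 = \<omega> - \<delta>\<close>, and
    \<open>w f = (-1) ^ rank f * q ^ (2n - rank f)\<close> (theorem \<open>hermitian_zeros\<close>).  A Hermitian form over a finite
    field is determined by its rank, so no discriminant or type enters, and the characteristic
    may be even or odd.

  Adding and subtracting the two divisibilities separates the parities of the rank: \<open>q ^ d\<close> divides
  twice the sum of \<open>q ^ (2n - rank f)\<close> over the \<open>f \<in> M\<close> of even rank, and likewise for odd rank
  (lemma \<open>card_dvd_parity_sum\<close>).  Let \<open>r\<close> and \<open>l\<close> have opposite parity and let \<open>A\<^sub>r\<close> and \<open>A\<^sub>l\<close> be the numbers
  of forms of these ranks.  Each parity class then contains a single nonzero rank, and if \<open>d > 2n - r\<close>
  it follows that \<open>q\<close> divides \<open>2 A\<^sub>r\<close> and \<open>2 A\<^sub>l\<close> (lemma \<open>field_order_dvd_twice_card_rank\<close>).  But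
  \<open>A\<^sub>r + A\<^sub>l = q ^ d - 1\<close>, so \<open>q\<close> divides \<open>2\<close>, which leaves only \<open>q = 2\<close>.
\<close>

section \<open>Counting in vector spaces over a finite field\<close>

lemma field_order_gt_1: "1 < CARD('k::{field,finite})"
  using card_mono[of UNIV "{0, 1 :: 'k}"] by auto

lemma finite_set_of_forms:
  fixes M :: "('v \<Rightarrow> 'v \<Rightarrow> 'k::finite) set"
  assumes "finite (UNIV :: 'v set)"
  shows "finite M"
proof (rule finite_subset[OF subset_UNIV])
  show "finite (UNIV :: ('v \<Rightarrow> 'v \<Rightarrow> 'k) set)"
    using assms by (simp add: finite_UNIV_fun)
qed

locale finite_field_space = vector_space scale
  for scale :: "'k::{field,finite} \<Rightarrow> 'v::ab_group_add \<Rightarrow> 'v"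
begin

text \<open>
  The set on the right is the internal direct sum of the line through \<open>b\<close> and \<open>P\<close>.  In this form it
  is what \<open>span_breakdown_eq\<close> produces, and it serves for spans, for kernels of functionals and for
  radicals alike.
\<close>

lemma bij_betw_line_sum:
  assumes P: "subspace P" and b: "b \<notin> P"
  shows "bij_betw (\<lambda>(c, x). scale c b + x) (UNIV \<times> P) {y. \<exists>c. y - scale c b \<in> P}"
proof (rule bij_betwI')
  fix p p' :: "'k \<times> 'v"
  assume "p \<in> UNIV \<times> P" "p' \<in> UNIV \<times> P"
  then obtain c x c' x' where p: "p = (c, x)" "p' = (c', x')" "x \<in> P" "x' \<in> P"
    by auto
  have "c = c'" if eq: "scale c b + x = scale c' b + x'"
  proof (rule ccontr)
    assume "c \<noteq> c'"
    have "scale (c - c') b = x' - x"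
      using eq by (simp add: scale_left_diff_distrib algebra_simps)
    then have "scale (inverse (c - c')) (scale (c - c') b) \<in> P"
      using p subspace_diff[OF P] subspace_scale[OF P] by metis
    then show False using b \<open>c \<noteq> c'\<close> by simp
  qed
  then show "((case p of (c, x) \<Rightarrow> scale c b + x) = (case p' of (c, x) \<Rightarrow> scale c b + x))
      = (p = p')"
    using p by auto
next
  fix p assume "p \<in> (UNIV :: 'k set) \<times> P"
  then show "(case p of (c, x) \<Rightarrow> scale c b + x) \<in> {y. \<exists>c. y - scale c b \<in> P}"
    by (auto intro!: exI[of _ "fst p"] simp: case_prod_beta)
next
  fix y assume "y \<in> {y. \<exists>c. y - scale c b \<in> P}"
  then obtain c where "y - scale c b \<in> P" by auto
  then show "\<exists>p\<in>UNIV \<times> P. y = (case p of (c, x) \<Rightarrow> scale c b + x)"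
    by (intro bexI[of _ "(c, y - scale c b)"]) auto
qed

lemma card_line_sum:
  assumes "subspace P" "b \<notin> P"
  shows "card {y. \<exists>c. y - scale c b \<in> P} = CARD('k) * card P"
  using bij_betw_same_card[OF bij_betw_line_sum[OF assms]] by (simp add: card_cartesian_product)

lemma finite_line_sum:
  assumes "subspace P" "b \<notin> P" "finite P"
  shows "finite {y. \<exists>c. y - scale c b \<in> P}"
  using bij_betw_finite[OF bij_betw_line_sum[OF assms(1,2)]] assms(3) by simp

lemma card_span_independent:
  assumes "finite B" "independent B"
  shows "finite (span B) \<and> card (span B) = CARD('k) ^ card B"
  using assms
proof (induction B)
  case empty
  then show ?case by simp
next
  case (insert b B)
  then have "b \<notin> span B" "independent B"
    by (simp_all add: independent_insert)
  moreover have "span (insert b B) = {y. \<exists>c. y - scale c b \<in> span B}"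
    using span_breakdown_eq by auto
  ultimately show ?case
    using insert card_line_sum[of "span B" b] finite_line_sum[of "span B" b] by simp
qed

lemma card_subspace:
  assumes S: "subspace S" and "finite S"
  shows "card S = CARD('k) ^ dim S"
proof -
  obtain B where B: "B \<subseteq> S" "independent B" "S \<subseteq> span B" "card B = dim S"
    using basis_exists by blast
  have "finite B" using B(1) \<open>finite S\<close> finite_subset by blast
  moreover have "span B = S"
    using B span_minimal[OF B(1) S] by auto
  ultimately show ?thesis
    using card_span_independent B by metis
qed

text \<open>
  The functional is given only on \<open>S\<close>: if it is nonzero at \<open>b\<close>, then \<open>S\<close> is the direct sum of its kernel
  and the line through \<open>b\<close>.
\<close>

lemma card_linear_zeros:
  assumes S: "subspace S"
    and add: "\<And>x y. x \<in> S \<Longrightarrow> y \<in> S \<Longrightarrow> \<phi> (x + y) = \<phi> x + \<phi> y"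
    and scl: "\<And>c x. x \<in> S \<Longrightarrow> \<phi> (scale c x) = c * \<phi> x"
  shows "CARD('k) * card {x \<in> S. \<phi> x = (0::'k)}
    = card S * (if \<forall>x\<in>S. \<phi> x = 0 then CARD('k) else 1)"
proof (cases "\<forall>x\<in>S. \<phi> x = 0")
  case True
  then have "{x \<in> S. \<phi> x = 0} = S" by auto
  then show ?thesis using True by simp
next
  case False
  then obtain b where b: "b \<in> S" "\<phi> b \<noteq> 0" by blast
  let ?K = "{x \<in> S. \<phi> x = 0}"
  have 0: "\<phi> 0 = 0"
    using scl[of 0 0] subspace_0[OF S] by simp
  have K: "subspace ?K"
    using S add scl 0 by (auto simp: subspace_def)
  have dec: "\<phi> (y - scale c b) = \<phi> y - c * \<phi> b" if "y \<in> S" for y c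
    using add[of y "scale (- c) b"] scl[of b "- c"] that b subspace_scale[OF S, of b "- c"]
    by simp
  have "{y. \<exists>c. y - scale c b \<in> ?K} = S"
  proof (intro equalityI subsetI)
    fix y assume "y \<in> {y. \<exists>c. y - scale c b \<in> ?K}"
    then obtain c where "y - scale c b \<in> S" by auto
    then have "y - scale c b + scale c b \<in> S"
      using subspace_add[OF S] subspace_scale[OF S] b(1) by blast
    then show "y \<in> S" by simp
  next
    fix y assume "y \<in> S"
    then show "y \<in> {y. \<exists>c. y - scale c b \<in> ?K}"
      using dec[of y "\<phi> y / \<phi> b"] b subspace_diff[OF S] subspace_scale[OF S] by auto
  qed
  then show ?thesis
    using card_line_sum[OF K, of b] b False by auto
qed

text \<open>
  The double count behind the theorem.  Let \<open>C\<close> be the set of common zeros of \<open>S\<close> in \<open>Z\<close>.  A point of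
  \<open>C\<close> is a zero of all of \<open>S\<close>, any other point of exactly \<open>|S| / q\<close> elements.  Comparing the two counts
  of the pairs \<open>(x, z)\<close> with \<open>ev z x = 0\<close> shows that the weights add up to \<open>|S| |C|\<close>.
\<close>

lemma card_dvd_weight_sum:
  fixes ev :: "'z \<Rightarrow> 'v \<Rightarrow> 'k" and w :: "'v \<Rightarrow> int"
  assumes S: "subspace S" and "finite S" and "finite Z"
    and add: "\<And>z x y. x \<in> S \<Longrightarrow> y \<in> S \<Longrightarrow> ev z (x + y) = ev z x + ev z y"
    and scl: "\<And>z c x. x \<in> S \<Longrightarrow> ev z (scale c x) = c * ev z x"
    and w: "\<And>x. x \<in> S \<Longrightarrow>
      int CARD('k) * int (card {z \<in> Z. ev z x = 0}) = int (card Z) + (int CARD('k) - 1) * w x"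
  shows "int (card S) dvd (\<Sum>x\<in>S. w x)"
proof -
  let ?q = "int CARD('k)"
  define C where "C = {z \<in> Z. \<forall>x\<in>S. ev z x = 0}"
  have q: "?q \<noteq> 1"
    using field_order_gt_1[where 'k='k] by simp
  have "(\<Sum>x\<in>S. card {z \<in> Z. ev z x = 0}) = (\<Sum>z\<in>Z. card {x \<in> S. ev z x = 0})"
    by (rule sum_multicount_gen) (use assms in auto)
  then have "(\<Sum>x\<in>S. ?q * int (card {z \<in> Z. ev z x = 0}))
      = (\<Sum>z\<in>Z. ?q * int (card {x \<in> S. ev z x = 0}))"
    unfolding sum_distrib_left[symmetric] of_nat_sum[symmetric] by simp
  also have "\<dots> = (\<Sum>z\<in>Z. int (card S) * (1 + (?q - 1) * of_bool (z \<in> C)))"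
  proof (rule sum.cong[OF refl])
    fix z assume "z \<in> Z"
    have "CARD('k) * card {x \<in> S. ev z x = 0}
      = card S * (if \<forall>x\<in>S. ev z x = 0 then CARD('k) else 1)"
      by (rule card_linear_zeros[OF S add scl])
    then have "?q * int (card {x \<in> S. ev z x = 0})
      = int (card S) * (if \<forall>x\<in>S. ev z x = 0 then ?q else 1)"
      unfolding of_nat_mult[symmetric] by simp
    then show "?q * int (card {x \<in> S. ev z x = 0})
      = int (card S) * (1 + (?q - 1) * of_bool (z \<in> C))"
      using \<open>z \<in> Z\<close> by (simp add: C_def)
  qed
  also have "\<dots> = int (card S) * (int (card Z) + (?q - 1) * int (card C))"
  proof -
    have "Z \<inter> C = C" by (auto simp: C_def)
    then have "(\<Sum>z\<in>Z. of_bool (z \<in> C) :: int) = int (card C)"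
      using \<open>finite Z\<close> by (simp add: of_bool_def sum.If_cases Int_def)
    then show ?thesis
      by (simp add: sum_distrib_left[symmetric] sum.distrib)
  qed
  finally have "(\<Sum>x\<in>S. int (card Z) + (?q - 1) * w x)
      = int (card S) * (int (card Z) + (?q - 1) * int (card C))"
    using w by simp
  then have "(?q - 1) * (\<Sum>x\<in>S. w x) = (?q - 1) * (int (card S) * int (card C))"
    by (simp add: sum.distrib sum_distrib_left[symmetric] distrib_left mult.left_commute)
  then show ?thesis using q by simp
qed

end

section \<open>The norm form of the quadratic extension\<close>

text \<open>
  If \<open>\<omega>\<close> is a root of \<open>X\<^sup>2 - X + \<delta>\<close>, with conjugate \<open>1 - \<omega>\<close>, this is the value at \<open>x + \<omega> y\<close> of the
  Hermitian form over \<open>k(\<omega>)\<close> that extends \<open>f\<close>.  The pair \<open>(x, y)\<close> stands for the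
  vector \<open>x + \<omega> y\<close> over \<open>k(\<omega>)\<close>, so that all counting takes place over \<open>k\<close>.
\<close>

definition hermitian_ext :: "'k::field \<Rightarrow> ('v \<Rightarrow> 'v \<Rightarrow> 'k) \<Rightarrow> 'v \<times> 'v \<Rightarrow> 'k"
  where "hermitian_ext \<delta> f z = f (fst z) (fst z) + f (fst z) (snd z) + \<delta> * f (snd z) (snd z)"

text \<open>
  Equivalently, the norm \<open>a\<^sup>2 + a b + \<delta> b\<^sup>2\<close> of \<open>a + b \<omega>\<close> vanishes only at \<open>0\<close>.  The linear term makes the
  condition satisfiable in every characteristic: \<open>a\<^sup>2 + a\<close> is never an injective map, whereas \<open>a\<^sup>2\<close> is
  a bijection of a finite field of characteristic 2.
\<close>

definition anisotropic :: "'k::field \<Rightarrow> bool"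
  where "anisotropic \<delta> \<longleftrightarrow> (\<forall>a. a * a + a + \<delta> \<noteq> 0)"

lemma ex_anisotropic: "\<exists>\<delta>::'k::{field,finite}. anisotropic \<delta>"
proof -
  have "\<not> inj (\<lambda>a::'k. a * a + a)"
  proof
    assume "inj (\<lambda>a::'k. a * a + a)"
    then have "(0::'k) = - 1" by (rule injD) simp
    then show False by simp
  qed
  then have "\<not> surj (\<lambda>a::'k. a * a + a)"
    using finite_UNIV_surj_inj[OF finite] by blast
  then obtain c where c: "\<And>a::'k. c \<noteq> a * a + a"
    unfolding surj_def by blast
  have "anisotropic (- c)"
    unfolding anisotropic_def using c by (metis eq_neg_iff_add_eq_0 minus_minus)
  then show ?thesis by blast
qed

lemma norm_nonzero:
  assumes "anisotropic \<delta>" and "a \<noteq> 0 \<or> b \<noteq> 0"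
  shows "a * a + a * b + \<delta> * (b * b) \<noteq> 0"
proof (cases "b = 0")
  case True
  then show ?thesis using assms by simp
next
  case False
  have "(a / b) * (a / b) + a / b + \<delta> \<noteq> 0"
    using assms unfolding anisotropic_def by blast
  moreover have "a * a + a * b + \<delta> * (b * b) = ((a / b) * (a / b) + a / b + \<delta>) * (b * b)"
    using False by (simp add: field_simps)
  ultimately show ?thesis using False by simp
qed

lemma card_squares:
  "CARD('k) < 2 * card (range (\<lambda>x::'k::{field,finite}. x * x))"
proof -
  let ?A = "range (\<lambda>x::'k. x * x)"
  \<comment> \<open>A square root function: every field element is a root or minus a root, and \<open>0\<close> is counted once.\<close>
  define g :: "'k \<Rightarrow> 'k" where "g s = (SOME x. x * x = s)" for s
  have g: "g (x * x) * g (x * x) = x * x" for x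
    unfolding g_def by (rule someI) simp
  have "UNIV \<subseteq> g ` ?A \<union> (\<lambda>s. - g s) ` (?A - {0})"
  proof
    fix x :: 'k
    have "x = g (x * x) \<or> x = - g (x * x)"
      using g[of x] by (auto simp: square_eq_iff)
    moreover have "x = g (x * x)" if "x = 0" using g[of 0] that by simp
    ultimately show "x \<in> g ` ?A \<union> (\<lambda>s. - g s) ` (?A - {0})"
      by (cases "x = 0") auto
  qed
  then have "CARD('k) \<le> card (g ` ?A \<union> (\<lambda>s. - g s) ` (?A - {0}))"
    by (intro card_mono) auto
  also have "\<dots> \<le> card (g ` ?A) + card ((\<lambda>s. - g s) ` (?A - {0}))"
    by (rule card_Un_le)
  also have "\<dots> \<le> card ?A + card (?A - {0})"
    by (intro add_mono card_image_le) auto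
  also have "card (?A - {0}) < card ?A"
    by (rule card_Diff1_less) (auto intro!: image_eqI[of _ _ 0])
  finally show ?thesis by simp
qed

text \<open>
  In characteristic 2 every element is a square, which is the norm of some \<open>a + 0 \<omega>\<close>.  Otherwise
  completing the square turns the equation into \<open>u\<^sup>2 + (4\<delta> - 1) w\<^sup>2 = 4c\<close>, and both \<open>u\<^sup>2\<close> and
  \<open>4c - (4\<delta> - 1) w\<^sup>2\<close> take more than \<open>q / 2\<close> values, so they have a value in common.
\<close>

lemma norm_surj:
  fixes \<delta> :: "'k::{field,finite}"
  assumes "anisotropic \<delta>"
  shows "\<exists>a b. a * a + a * b + \<delta> * (b * b) = c"
proof (cases "(2::'k) = 0")
  case True
  have "inj (\<lambda>x::'k. x * x)"
  proof (rule injI)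
    fix x y :: 'k assume "x * x = y * y"
    moreover have "y + y = 0" using True by (metis mult_2 mult_zero_left)
    ultimately show "x = y" by (metis square_eq_iff eq_neg_iff_add_eq_0)
  qed
  then have "surj (\<lambda>x::'k. x * x)" using finite_UNIV_inj_surj[OF finite] by blast
  then obtain a where "c = a * a" unfolding surj_def by blast
  then show ?thesis by (intro exI[of _ a] exI[of _ 0]) simp
next
  case False
  define e where "e = 4 * \<delta> - 1"
  have e: "e \<noteq> 0"
    using norm_nonzero[OF assms, of 1 "- 2"] unfolding e_def by (simp add: algebra_simps)
  let ?A = "range (\<lambda>x::'k. x * x)" and ?B = "range (\<lambda>x::'k. 4 * c - e * (x * x))"
  have "?B = (\<lambda>s. 4 * c - e * s) ` ?A" by auto
  moreover have "inj_on (\<lambda>s. 4 * c - e * s) ?A" using e by (auto simp: inj_on_def)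
  ultimately have "card ?B = card ?A" by (simp add: card_image)
  moreover have "card (?A \<union> ?B) \<le> CARD('k)" by (intro card_mono) auto
  ultimately have "?A \<inter> ?B \<noteq> {}"
    using card_squares[where ?'k='k] card_Un_disjoint[of ?A ?B] by force
  then obtain u w where uw: "u * u = 4 * c - e * (w * w)" by auto
  define a where "a = (u - w) / 2"
  have u: "u = 2 * a + w" using False unfolding a_def
    by (metis diff_add_cancel nonzero_mult_div_cancel_left times_divide_eq_right)
  have "4 * (a * a + a * w + \<delta> * (w * w)) = u * u + e * (w * w)"
    by (simp add: u e_def algebra_simps)
  also have "\<dots> = 4 * c" using uw by simp
  finally have "2 * (2 * (a * a + a * w + \<delta> * (w * w))) = 2 * (2 * c)" by simp
  then have "a * a + a * w + \<delta> * (w * w) = c"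
    unfolding mult_left_cancel[OF False] .
  then show ?thesis by blast
qed

section \<open>Symmetric forms and their Hermitian extensions\<close>

locale symmetric_form = finite_field_space scale
  for scale :: "'k::{field,finite} \<Rightarrow> 'v::ab_group_add \<Rightarrow> 'v" +
  fixes f :: "'v \<Rightarrow> 'v \<Rightarrow> 'k"
  assumes commute: "f u v = f v u"
    and add_left: "f (u + v) w = f u w + f v w"
    and scale_left: "f (scale c u) w = c * f u w"
begin

lemma add_right: "f w (u + v) = f w u + f w v"
  using add_left commute by metis

lemma scale_right: "f w (scale c u) = c * f w u"
  using scale_left commute by metis

lemma zero_left [simp]: "f 0 w = 0"
  using scale_left[of 0 0] by simp

lemma zero_right [simp]: "f w 0 = 0"
  using commute by simp

lemma minus_left: "f (- u) w = - f u w"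
  using scale_left[of "- 1" u] by simp

lemma minus_right: "f w (- u) = - f w u"
  using scale_right[of w "- 1" u] by simp

lemma diff_left: "f (u - v) w = f u w - f v w"
  using add_left[of u "- v"] minus_left by simp

lemma diff_right: "f w (u - v) = f w u - f w v"
  using add_right[of w u "- v"] minus_right by simp

lemmas expand = add_left add_right scale_left scale_right diff_left diff_right

definition radical_on :: "'v set \<Rightarrow> 'v set"
  where "radical_on W = {u \<in> W. \<forall>x\<in>W. f u x = 0}"

lemma subspace_radical_on:
  assumes "subspace W"
  shows "subspace (radical_on W)"
  using assms by (auto simp: subspace_def radical_on_def expand)

definition perp :: "'v set \<Rightarrow> 'v \<Rightarrow> 'v set"
  where "perp W v = {x \<in> W. f v x = 0}"

lemma subspace_perp:
  assumes "subspace W"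
  shows "subspace (perp W v)"
  using assms by (auto simp: subspace_def perp_def expand)

lemma card_perp:
  assumes "subspace W" "w \<in> W" "f v w \<noteq> 0"
  shows "card W = CARD('k) * card (perp W v)"
  using card_linear_zeros[OF assms(1), of "f v"] assms by (auto simp: expand perp_def)

text \<open>
  Multiplication by the scalar \<open>a + b \<omega>\<close> maps \<open>x + \<omega> y\<close> to the displayed pair, because
  \<open>\<omega>\<^sup>2 = \<omega> - \<delta>\<close>; it multiplies a Hermitian form by the norm of the scalar.
\<close>

lemma hermitian_ext_twist:
  "hermitian_ext \<delta> f (scale a x - scale (\<delta> * b) y, scale b x + scale (a + b) y)
    = (a * a + a * b + \<delta> * (b * b)) * hermitian_ext \<delta> f (x, y)"
  using commute[of y x] by (simp add: hermitian_ext_def expand algebra_simps)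

text \<open>
  A scalar of norm \<open>d / c\<close> maps the fibre over \<open>c\<close> injectively into the fibre over \<open>d\<close>.  Hence all fibres
  over nonzero values have the same size, and the number of zeros determines it.
\<close>

lemma card_hermitian_fibre_le:
  assumes \<delta>: "anisotropic \<delta>" and W: "subspace W" "finite W" and "c \<noteq> 0" "d \<noteq> 0"
  shows "card {z \<in> W \<times> W. hermitian_ext \<delta> f z = c} \<le> card {z \<in> W \<times> W. hermitian_ext \<delta> f z = d}"
proof -
  obtain a b where N: "a * a + a * b + \<delta> * (b * b) = d / c"
    using norm_surj[OF \<delta>] by blast
  define T where "T z = (scale a (fst z) - scale (\<delta> * b) (snd z),
    scale b (fst z) + scale (a + b) (snd z))" for z
  \<comment> \<open>The combinations below multiply by the conjugate scalar, which inverts \<open>T\<close> up to the norm.\<close>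
  have fst: "scale (a + b) (fst (T z)) + scale (\<delta> * b) (snd (T z)) = scale (d / c) (fst z)"
    and snd: "scale a (snd (T z)) - scale b (fst (T z)) = scale (d / c) (snd z)" for z
    unfolding T_def N[symmetric] by (simp_all add: algebra_simps)
  have "inj_on T (W \<times> W)"
  proof (rule inj_onI)
    fix z z' assume eq: "T z = T z'"
    have "scale (d / c) (fst z) = scale (d / c) (fst z')"
      and "scale (d / c) (snd z) = scale (d / c) (snd z')"
      unfolding fst[symmetric] snd[symmetric] eq by simp_all
    then show "z = z'" using \<open>c \<noteq> 0\<close> \<open>d \<noteq> 0\<close> by (simp add: prod_eq_iff)
  qed
  moreover have "T ` {z \<in> W \<times> W. hermitian_ext \<delta> f z = c} \<subseteq> {z \<in> W \<times> W. hermitian_ext \<delta> f z = d}"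
    using W(1) \<open>c \<noteq> 0\<close>
    by (auto simp: T_def hermitian_ext_twist N subspace_diff subspace_add subspace_scale)
  ultimately show ?thesis
    using W(2) by (intro card_inj_on_le[of T]) (auto intro: inj_on_subset)
qed

lemma card_hermitian_fibres:
  assumes "anisotropic \<delta>" and "subspace W" "finite W" and "c \<noteq> 0"
  shows "int (card W) ^ 2 = int (card {z \<in> W \<times> W. hermitian_ext \<delta> f z = 0})
    + (int CARD('k) - 1) * int (card {z \<in> W \<times> W. hermitian_ext \<delta> f z = c})"
proof -
  define D where "D d = card {z \<in> W \<times> W. hermitian_ext \<delta> f z = d}" for d
  have D: "D d = D c" if "d \<noteq> 0" for d
    unfolding D_def using card_hermitian_fibre_le[OF assms(1-3)] \<open>c \<noteq> 0\<close> that
    by (simp add: le_antisym)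
  have "card (W \<times> W) = (\<Sum>d\<in>UNIV. D d)"
    using sum.group[of "W \<times> W" UNIV "hermitian_ext \<delta> f" "\<lambda>_. 1 :: nat"] \<open>finite W\<close>
    by (simp add: D_def)
  also have "\<dots> = D 0 + (\<Sum>d\<in>UNIV - {0}. D d)"
    by (rule sum.remove) auto
  also have "(\<Sum>d\<in>UNIV - {0}. D d) = (CARD('k) - 1) * D c"
    using D by simp
  finally have "card W * card W = D 0 + (CARD('k) - 1) * D c"
    by (simp add: card_cartesian_product)
  then have "int (card W) * int (card W) = int (D 0) + int (CARD('k) - 1) * int (D c)"
    unfolding of_nat_mult[symmetric] of_nat_add[symmetric] by simp
  then show ?thesis
    by (simp add: D_def power2_eq_square of_nat_diff)
qed

text \<open>
  If \<open>f v v \<noteq> 0\<close>, then \<open>W\<close> is the orthogonal sum of the line through \<open>v\<close> and \<open>P = perp W v\<close>, and the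
  Hermitian form at \<open>(a v + x, b v + y)\<close> is \<open>f v v * N (a, b)\<close> plus its value at \<open>(x, y)\<close>, where \<open>N\<close> is
  the norm.  The pair \<open>(a, b) = (0, 0)\<close> contributes the zeros in \<open>P \<times> P\<close>, and each of the \<open>q\<^sup>2 - 1\<close> other
  pairs contributes a fibre over a nonzero value.
\<close>

lemma hermitian_zeros_nonisotropic:
  assumes \<delta>: "anisotropic \<delta>" and W: "subspace W" "finite W" and v: "v \<in> W" "f v v \<noteq> 0"
  shows "int (card {z \<in> W \<times> W. hermitian_ext \<delta> f z = 0})
    = (int CARD('k) + 1) * int (card (perp W v)) ^ 2
      - int CARD('k) * int (card {z \<in> perp W v \<times> perp W v. hermitian_ext \<delta> f z = 0})"
proof -
  define P where "P = perp W v"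
  define D where "D c = card {z \<in> P \<times> P. hermitian_ext \<delta> f z = c}" for c
  define N where "N = (\<lambda>(a, b). a * a + a * b + \<delta> * (b * b))"
  have P: "subspace P" "finite P" "P \<subseteq> W"
    using W subspace_perp by (auto simp: P_def perp_def)
  define A where "A = (SIGMA ab:UNIV. {z \<in> P \<times> P. hermitian_ext \<delta> f z = - (f v v * N ab)})"
  define \<pi> where "\<pi> x = f v x / f v v" for x
  have split: "hermitian_ext \<delta> f (scale a v + x, scale b v + y)
      = f v v * N (a, b) + hermitian_ext \<delta> f (x, y)" if "x \<in> P" "y \<in> P" for a b x y
    using that commute[of x v] commute[of y v]
    by (simp add: hermitian_ext_def expand N_def P_def perp_def algebra_simps)
  have "bij_betw (\<lambda>((a, b), (x, y)). (scale a v + x, scale b v + y)) A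
    {z \<in> W \<times> W. hermitian_ext \<delta> f z = 0}"
  proof (rule bij_betw_byWitness[where f' =
        "\<lambda>(x, y). ((\<pi> x, \<pi> y), (x - scale (\<pi> x) v, y - scale (\<pi> y) v))"])
    have "\<pi> (scale a v + x) = a" if "x \<in> P" for a x
      using that v by (simp add: \<pi>_def expand P_def perp_def)
    then show "\<forall>p\<in>A. (\<lambda>(x, y). ((\<pi> x, \<pi> y), (x - scale (\<pi> x) v, y - scale (\<pi> y) v)))
        ((\<lambda>((a, b), (x, y)). (scale a v + x, scale b v + y)) p) = p"
      by (auto simp: A_def)
    show "\<forall>z\<in>{z \<in> W \<times> W. hermitian_ext \<delta> f z = 0}.
        (\<lambda>((a, b), (x, y)). (scale a v + x, scale b v + y))
        ((\<lambda>(x, y). ((\<pi> x, \<pi> y), (x - scale (\<pi> x) v, y - scale (\<pi> y) v))) z) = z"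
      by auto
    show "(\<lambda>((a, b), (x, y)). (scale a v + x, scale b v + y)) ` A
        \<subseteq> {z \<in> W \<times> W. hermitian_ext \<delta> f z = 0}"
      using P W v by (auto simp: A_def split subspace_add subspace_scale)
    have proj: "x - scale (\<pi> x) v \<in> P" if "x \<in> W" for x
      using that v W by (simp add: P_def perp_def expand \<pi>_def subspace_diff subspace_scale)
    have "hermitian_ext \<delta> f (x - scale (\<pi> x) v, y - scale (\<pi> y) v) = - (f v v * N (\<pi> x, \<pi> y))"
      if "x \<in> W" "y \<in> W" "hermitian_ext \<delta> f (x, y) = 0" for x y
      using split[OF proj[OF that(1)] proj[OF that(2)], of "\<pi> x" "\<pi> y"] that(3)
      by (simp add: eq_neg_iff_add_eq_0 add.commute)
    then show "(\<lambda>(x, y). ((\<pi> x, \<pi> y), (x - scale (\<pi> x) v, y - scale (\<pi> y) v)))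
        ` {z \<in> W \<times> W. hermitian_ext \<delta> f z = 0} \<subseteq> A"
      using proj by (auto simp: A_def)
  qed
  then have "card {z \<in> W \<times> W. hermitian_ext \<delta> f z = 0} = card A"
    by (simp add: bij_betw_same_card)
  also have "\<dots> = (\<Sum>ab\<in>UNIV. D (- (f v v * N ab)))"
    unfolding A_def D_def using P by (intro card_SigmaI) auto
  finally have card: "int (card {z \<in> W \<times> W. hermitian_ext \<delta> f z = 0})
      = (\<Sum>ab\<in>UNIV. int (D (- (f v v * N ab))))"
    by simp
  let ?q = "int CARD('k)"
  have D: "(?q - 1) * int (D c) = int (card P) ^ 2 - int (D 0)" if "c \<noteq> 0" for c
    using card_hermitian_fibres[OF \<delta> P(1,2) that] by (simp add: D_def)
  have "(?q - 1) * int (card {z \<in> W \<times> W. hermitian_ext \<delta> f z = 0})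
      = (\<Sum>ab\<in>UNIV. (?q - 1) * int (D (- (f v v * N ab))))"
    by (simp add: card sum_distrib_left)
  also have "\<dots> = (?q - 1) * int (D 0)
      + (\<Sum>ab\<in>UNIV - {(0, 0)}. (?q - 1) * int (D (- (f v v * N ab))))"
    by (subst sum.remove[of _ "(0, 0)"]) (auto simp: N_def)
  also have "(\<Sum>ab\<in>UNIV - {(0, 0)}. (?q - 1) * int (D (- (f v v * N ab))))
      = (\<Sum>ab\<in>(UNIV :: ('k \<times> 'k) set) - {(0, 0)}. int (card P) ^ 2 - int (D 0))"
  proof (rule sum.cong[OF refl])
    fix ab :: "'k \<times> 'k" assume "ab \<in> UNIV - {(0, 0)}"
    then have "N ab \<noteq> 0"
      using norm_nonzero[OF \<delta>, of "fst ab" "snd ab"] by (cases ab) (auto simp: N_def)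
    then show "(?q - 1) * int (D (- (f v v * N ab))) = int (card P) ^ 2 - int (D 0)"
      using v D by simp
  qed
  also have "\<dots> = (?q ^ 2 - 1) * (int (card P) ^ 2 - int (D 0))"
  proof -
    have "card ((UNIV :: ('k \<times> 'k) set) - {(0, 0)}) = CARD('k) * CARD('k) - 1"
      by (simp add: card_prod)
    moreover have "CARD('k) * CARD('k) \<ge> 1" by (simp add: Suc_leI)
    ultimately show ?thesis by (simp add: of_nat_diff power2_eq_square)
  qed
  finally have "(?q - 1) * int (card {z \<in> W \<times> W. hermitian_ext \<delta> f z = 0})
      = (?q - 1) * ((?q + 1) * int (card P) ^ 2 - ?q * int (D 0))"
    by (simp add: algebra_simps power2_eq_square)
  moreover have "?q - 1 \<noteq> 0"
    using field_order_gt_1[where 'k='k] by simp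
  ultimately show ?thesis
    unfolding D_def P_def by simp
qed

lemma card_linear_equation_solutions:
  fixes \<alpha> \<beta> \<gamma> :: 'k
  assumes "\<alpha> \<noteq> 0 \<or> \<beta> \<noteq> 0"
  shows "card {st. \<gamma> + fst st * \<alpha> + snd st * \<beta> = 0} = CARD('k)"
proof (cases "\<alpha> = 0")
  case False
  then have "{st. \<gamma> + fst st * \<alpha> + snd st * \<beta> = 0} = range (\<lambda>t. (- (\<gamma> + t * \<beta>) / \<alpha>, t))"
    by (auto simp: field_simps add_eq_0_iff image_iff)
  then show ?thesis by (simp add: card_image inj_on_def)
next
  case True
  then have "{st. \<gamma> + fst st * \<alpha> + snd st * \<beta> = 0} = range (\<lambda>s. (s, - \<gamma> / \<beta>))"
    using assms by (auto simp: field_simps add_eq_0_iff image_iff)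
  then show ?thesis by (simp add: card_image inj_on_def)
qed

text \<open>
  If \<open>f v v = 0\<close>, translating a pair by \<open>(s v, t v)\<close> changes the value of the Hermitian form by a linear
  function of \<open>(s, t)\<close>.  For pairs outside \<open>P \<times> P\<close>, where \<open>P = perp W v\<close>, this function is nonzero, so
  exactly a \<open>q\<close>-th part of these pairs are zeros.
\<close>

lemma hermitian_zeros_isotropic:
  assumes \<delta>: "anisotropic \<delta>" and W: "subspace W" "finite W" and v: "v \<in> W" "f v v = 0"
  shows "int CARD('k) * int (card {z \<in> W \<times> W. hermitian_ext \<delta> f z = 0})
    = int CARD('k) * int (card {z \<in> perp W v \<times> perp W v. hermitian_ext \<delta> f z = 0})
      + int (card W) ^ 2 - int (card (perp W v)) ^ 2"
proof -
  define P where "P = perp W v"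
  have P: "P \<subseteq> W" "finite P" using W by (auto simp: P_def perp_def finite_subset)
  define X where "X = W \<times> W - P \<times> P"
  have X: "finite X" using W by (simp add: X_def)
  define \<tau> where "\<tau> st z = (fst z + scale (fst st) v, snd z + scale (snd st) v)" for st z
  define \<alpha> where "\<alpha> z = 2 * f v (fst z) + f v (snd z)" for z :: "'v \<times> 'v"
  define \<beta> where "\<beta> z = f v (fst z) + 2 * \<delta> * f v (snd z)" for z :: "'v \<times> 'v"
  have \<tau>: "hermitian_ext \<delta> f (\<tau> st z) = hermitian_ext \<delta> f z + fst st * \<alpha> z + snd st * \<beta> z" for st z
    using commute[of "fst z" v] commute[of "snd z" v] v
    by (simp add: \<tau>_def \<alpha>_def \<beta>_def hermitian_ext_def expand algebra_simps)
  have nz: "\<alpha> z \<noteq> 0 \<or> \<beta> z \<noteq> 0" if "z \<in> X" for z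
  proof (rule ccontr)
    assume "\<not> ?thesis"
    then have 0: "\<alpha> z = 0" "\<beta> z = 0" by auto
    \<comment> \<open>The determinant of the system \<open>\<alpha> z = \<beta> z = 0\<close> is \<open>4 \<delta> - 1\<close>, the norm of \<open>1 - 2 \<omega>\<close>.\<close>
    have "4 * \<delta> - 1 \<noteq> 0"
      using norm_nonzero[OF \<delta>, of 1 "- 2"] by (simp add: algebra_simps)
    moreover have "(4 * \<delta> - 1) * f v (fst z) = 2 * \<delta> * \<alpha> z - \<beta> z"
      "(4 * \<delta> - 1) * f v (snd z) = 2 * \<beta> z - \<alpha> z"
      by (simp_all add: \<alpha>_def \<beta>_def algebra_simps)
    ultimately have "f v (fst z) = 0" "f v (snd z) = 0" using 0 by auto
    then show False using that by (cases z) (auto simp: X_def P_def perp_def)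
  qed
  have "card {z \<in> X. hermitian_ext \<delta> f (\<tau> st z) = 0} = card {z \<in> X. hermitian_ext \<delta> f z = 0}" for st
  proof (rule bij_betw_same_card[of "\<tau> st"], rule bij_betw_byWitness[where f' = "\<tau> (- fst st, - snd st)"])
    have inv: "\<tau> (- fst st, - snd st) (\<tau> st z) = z" "\<tau> st (\<tau> (- fst st, - snd st) z) = z" for z
      by (simp_all add: \<tau>_def)
    have "z + scale c v \<in> W \<longleftrightarrow> z \<in> W" "z + scale c v \<in> P \<longleftrightarrow> z \<in> P" for z c
    proof -
      show W': "z + scale c v \<in> W \<longleftrightarrow> z \<in> W"
        using subspace_add[OF W(1)] subspace_scale[OF W(1) v(1)] add_diff_cancel_right'
          subspace_diff[OF W(1)] by metis
      show "z + scale c v \<in> P \<longleftrightarrow> z \<in> P"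
        by (simp add: P_def perp_def W' expand v)
    qed
    then have inX: "\<tau> st z \<in> X \<longleftrightarrow> z \<in> X" for st z
      by (cases z) (simp add: \<tau>_def X_def)
    show "\<forall>z\<in>{z \<in> X. hermitian_ext \<delta> f (\<tau> st z) = 0}. \<tau> (- fst st, - snd st) (\<tau> st z) = z"
      "\<forall>z\<in>{z \<in> X. hermitian_ext \<delta> f z = 0}. \<tau> st (\<tau> (- fst st, - snd st) z) = z"
      "\<tau> st ` {z \<in> X. hermitian_ext \<delta> f (\<tau> st z) = 0} \<subseteq> {z \<in> X. hermitian_ext \<delta> f z = 0}"
      "\<tau> (- fst st, - snd st) ` {z \<in> X. hermitian_ext \<delta> f z = 0} \<subseteq> {z \<in> X. hermitian_ext \<delta> f (\<tau> st z) = 0}"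
      by (auto simp: inv inX image_subset_iff)
  qed
  then have "CARD('k \<times> 'k) * card {z \<in> X. hermitian_ext \<delta> f z = 0}
      = (\<Sum>st\<in>UNIV. card {z \<in> X. hermitian_ext \<delta> f (\<tau> st z) = 0})"
    by simp
  also have "\<dots> = (\<Sum>z\<in>X. CARD('k))"
  proof (rule sum_multicount_gen)
    show "\<forall>z\<in>X. card {st \<in> UNIV. hermitian_ext \<delta> f (\<tau> st z) = 0} = CARD('k)"
    proof
      fix z assume "z \<in> X"
      then show "card {st \<in> UNIV. hermitian_ext \<delta> f (\<tau> st z) = 0} = CARD('k)"
        using card_linear_equation_solutions[OF nz, of z "hermitian_ext \<delta> f z"]
        by (simp add: \<tau>)
    qed
  qed (use X in auto)
  finally have "CARD('k) * card {z \<in> X. hermitian_ext \<delta> f z = 0} = card X"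
    by (simp add: card_prod)
  moreover have "{z \<in> W \<times> W. hermitian_ext \<delta> f z = 0}
      = {z \<in> X. hermitian_ext \<delta> f z = 0} \<union> {z \<in> P \<times> P. hermitian_ext \<delta> f z = 0}"
    using P by (auto simp: X_def)
  then have "card {z \<in> W \<times> W. hermitian_ext \<delta> f z = 0}
      = card {z \<in> X. hermitian_ext \<delta> f z = 0} + card {z \<in> P \<times> P. hermitian_ext \<delta> f z = 0}"
    using X P by (simp add: card_Un_disjoint X_def disjoint_iff)
  moreover have "card (W \<times> W) = card X + card (P \<times> P)"
    using card_Un_disjoint[of X "P \<times> P"] X P W
    by (metis X_def Diff_disjoint Diff_partition Int_commute Sigma_mono Un_commute finite_SigmaI)
  then have "int (card W) ^ 2 = int (card X) + int (card P) ^ 2"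
    unfolding card_cartesian_product power2_eq_square of_nat_mult[symmetric] of_nat_add[symmetric]
    by simp
  ultimately show ?thesis
    unfolding P_def[symmetric] by (simp add: distrib_left flip: of_nat_mult)
qed

lemma radical_on_perp_nonisotropic:
  assumes "subspace W" "v \<in> W" "f v v \<noteq> 0"
  shows "radical_on (perp W v) = radical_on W"
proof (intro equalityI subsetI)
  fix u assume u: "u \<in> radical_on (perp W v)"
  have "f u x = 0" if "x \<in> W" for x
  proof -
    define c where "c = f v x / f v v"
    have "x - scale c v \<in> perp W v"
      using that assms by (simp add: perp_def c_def expand subspace_diff subspace_scale)
    then have "f u (x - scale c v) = 0" using u by (simp add: radical_on_def)
    moreover have "f u v = 0" using u commute by (simp add: radical_on_def perp_def)
    ultimately show ?thesis by (simp add: expand)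
  qed
  then show "u \<in> radical_on W" using u by (auto simp: radical_on_def perp_def)
next
  fix u assume "u \<in> radical_on W"
  then show "u \<in> radical_on (perp W v)"
    using assms commute by (auto simp: radical_on_def perp_def)
qed

text \<open>
  Here \<open>v\<close> itself lies in \<open>perp W v\<close> and spans the radical of the restricted form together with the
  radical of \<open>W\<close>: an element \<open>u\<close> orthogonal to the hyperplane \<open>perp W v\<close> satisfies \<open>f u = c (f v)\<close> on
  \<open>W\<close> for some \<open>c\<close>.
\<close>

lemma card_radical_on_perp_isotropic:
  assumes W: "subspace W" "v \<in> W" "f v v = 0" and v: "v \<notin> radical_on W"
  shows "card (radical_on (perp W v)) = CARD('k) * card (radical_on W)"
proof -
  obtain w where w: "w \<in> W" "f v w \<noteq> 0"
    using W v by (auto simp: radical_on_def)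
  have "radical_on (perp W v) = {y. \<exists>c. y - scale c v \<in> radical_on W}"
  proof (intro equalityI subsetI)
    fix u assume u: "u \<in> radical_on (perp W v)"
    define c where "c = f u w / f v w"
    have "f (u - scale c v) x = 0" if "x \<in> W" for x
    proof -
      define b where "b = f v x / f v w"
      have "x - scale b w \<in> perp W v"
        using that W w by (simp add: perp_def b_def expand subspace_diff subspace_scale)
      then have "f u (x - scale b w) = 0" using u by (simp add: radical_on_def)
      then show ?thesis using w by (simp add: expand c_def b_def)
    qed
    moreover have "u - scale c v \<in> W"
      using u W by (simp add: radical_on_def perp_def subspace_diff subspace_scale)
    ultimately show "u \<in> {y. \<exists>c. y - scale c v \<in> radical_on W}"
      by (auto simp: radical_on_def)
  next
    fix u assume "u \<in> {y. \<exists>c. y - scale c v \<in> radical_on W}"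
    then obtain c where c: "u - scale c v \<in> radical_on W" by auto
    then have "u - scale c v + scale c v \<in> W"
      using W by (intro subspace_add subspace_scale) (auto simp: radical_on_def)
    then have "u \<in> W" by simp
    moreover have f: "f u x = c * f v x" if "x \<in> W" for x
      using c that by (simp add: radical_on_def expand)
    ultimately show "u \<in> radical_on (perp W v)"
      using W commute[of v u] by (simp add: radical_on_def perp_def)
  qed
  then show ?thesis
    using card_line_sum[OF subspace_radical_on[OF W(1)] v] by simp
qed

text \<open>
  The exponent \<open>\<rho>\<close> is the rank of \<open>f\<close> on \<open>W\<close>; cardinalities instead of dimensions keep the induction
  free of bases.  Replace \<open>W\<close> by \<open>perp W v\<close> for some \<open>v\<close> outside the radical.  If \<open>f v v = 0\<close>, the rank
  drops by 2 and the excess of zeros does not change.  Otherwise the rank drops by 1, and the excess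
  of \<open>W\<close> is \<open>- q\<close> times that of \<open>perp W v\<close>, which is where the sign comes from.
\<close>

theorem hermitian_zeros:
  assumes \<delta>: "anisotropic \<delta>" and W: "subspace W" "finite W"
  shows "\<exists>\<rho>. card W = CARD('k) ^ \<rho> * card (radical_on W) \<and>
    int CARD('k) * int (card {z \<in> W \<times> W. hermitian_ext \<delta> f z = 0})
      = int (card W) ^ 2
        + (int CARD('k) - 1) * ((- 1) ^ \<rho> * int (card W) * int (card (radical_on W)))"
  using W
proof (induction "card W" arbitrary: W rule: less_induct)
  case less
  let ?q = "int CARD('k)"
  let ?Z = "\<lambda>W. int (card {z \<in> W \<times> W. hermitian_ext \<delta> f z = 0})"
  show ?case
  proof (cases "radical_on W = W")
    case True
    then have "f u x = 0" if "u \<in> W" "x \<in> W" for u x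
      using that unfolding radical_on_def by blast
    then have "{z \<in> W \<times> W. hermitian_ext \<delta> f z = 0} = W \<times> W"
      by (auto simp: hermitian_ext_def)
    then show ?thesis
      using True by (intro exI[of _ 0]) (simp add: card_cartesian_product power2_eq_square algebra_simps)
  next
    case False
    then obtain v where v: "v \<in> W" "v \<notin> radical_on W" by (auto simp: radical_on_def)
    then obtain w where w: "w \<in> W" "f v w \<noteq> 0" by (auto simp: radical_on_def)
    let ?P = "perp W v"
    have W: "card W = CARD('k) * card ?P"
      by (rule card_perp[OF less.prems(1) w])
    have "0 < card ?P"
      using less.prems subspace_0[OF subspace_perp[OF less.prems(1)]]
      by (auto simp: card_gt_0_iff perp_def)
    then have "card ?P < card W" using W field_order_gt_1[where 'k='k] by simp
    moreover have "finite ?P" using less.prems(2) by (simp add: perp_def)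
    ultimately obtain \<rho> where \<rho>: "card ?P = CARD('k) ^ \<rho> * card (radical_on ?P)"
      "?q * ?Z ?P = int (card ?P) ^ 2
        + (?q - 1) * ((- 1) ^ \<rho> * int (card ?P) * int (card (radical_on ?P)))"
      using less.hyps[of ?P] subspace_perp[OF less.prems(1)] by blast
    show ?thesis
    proof (cases "f v v = 0")
      case True
      have R: "card (radical_on ?P) = CARD('k) * card (radical_on W)"
        by (rule card_radical_on_perp_isotropic[OF less.prems(1) v(1) True v(2)])
      have "?q * ?Z W = int (card W) ^ 2
          + (?q - 1) * ((- 1) ^ \<rho> * int (card ?P) * int (card (radical_on ?P)))"
        using hermitian_zeros_isotropic[OF \<delta> less.prems v(1) True] \<rho>(2) by simp
      then show ?thesis
        using \<rho>(1) by (intro exI[of _ "\<rho> + 2"]) (simp add: W R algebra_simps power_add)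
    next
      case False
      have R: "radical_on ?P = radical_on W"
        by (rule radical_on_perp_nonisotropic[OF less.prems(1) v(1) False])
      have "?q * ?Z W = ?q * ((?q + 1) * int (card ?P) ^ 2 - ?q * ?Z ?P)"
        using hermitian_zeros_nonisotropic[OF \<delta> less.prems v(1) False] by simp
      also have "\<dots> = ?q * (?q * int (card ?P) ^ 2
          - (?q - 1) * ((- 1) ^ \<rho> * int (card ?P) * int (card (radical_on ?P))))"
        unfolding \<rho>(2) by (simp add: algebra_simps)
      finally show ?thesis
        using \<rho>(1)
        by (intro exI[of _ "\<rho> + 1"]) (simp add: W R algebra_simps power2_eq_square)
    qed
  qed
qed

text \<open>
  The equation \<open>f x y = 0\<close> in \<open>y\<close> has \<open>|V|\<close> solutions if \<open>x\<close> lies in the radical and \<open>|V| / q\<close> otherwise.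
\<close>

lemma bilinear_zeros:
  assumes "finite (UNIV :: 'v set)"
  shows "int CARD('k) * int (card {z. f (fst z) (snd z) = 0})
    = int CARD('v) ^ 2 + (int CARD('k) - 1) * (int CARD('v) * int (card (radical f)))"
proof -
  have row: "int CARD('k) * int (card {y. f x y = 0})
      = int CARD('v) * (1 + (int CARD('k) - 1) * of_bool (x \<in> radical f))" for x
  proof -
    have "CARD('k) * card {y \<in> UNIV. f x y = 0}
      = CARD('v) * (if \<forall>y\<in>UNIV. f x y = 0 then CARD('k) else 1)"
      by (rule card_linear_zeros) (simp_all add: expand)
    then show ?thesis
      unfolding of_nat_mult[symmetric] by (simp add: radical_def)
  qed
  have "{z. f (fst z) (snd z) = 0} = (SIGMA x:UNIV. {y. f x y = 0})" by auto
  then have "card {z. f (fst z) (snd z) = 0} = (\<Sum>x\<in>UNIV. card {y. f x y = 0})"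
    using assms by (simp add: finite_subset[OF subset_UNIV])
  then have "int CARD('k) * int (card {z. f (fst z) (snd z) = 0})
      = (\<Sum>x\<in>UNIV. int CARD('v) * (1 + (int CARD('k) - 1) * of_bool (x \<in> radical f)))"
    by (simp add: sum_distrib_left row)
  also have "\<dots> = int CARD('v) * (int CARD('v)
      + (int CARD('k) - 1) * (\<Sum>x\<in>UNIV. of_bool (x \<in> radical f)))"
    by (simp add: sum_distrib_left[symmetric] sum.distrib)
  also have "(\<Sum>x\<in>UNIV. of_bool (x \<in> radical f)) = int (card (radical f))"
    using assms by (simp add: of_bool_def sum.If_cases)
  finally show ?thesis by (simp add: power2_eq_square algebra_simps)
qed

end

lemma symmetric_form_Symm:
  fixes scale :: "'k::{field,finite} \<Rightarrow> 'v::ab_group_add \<Rightarrow> 'v"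
  assumes "vector_space scale" and f: "f \<in> Symm scale"
  shows "symmetric_form scale f"
proof -
  interpret V: vector_space scale by (fact assms)
  have L: "Vector_Spaces.linear scale (*) (\<lambda>u. f u w)" for w
    using f by (simp add: Symm_def bilinear_form_def)
  show ?thesis
  proof unfold_locales
    show "f u v = f v u" for u v
      using f by (simp add: Symm_def)
    show "f (u + v) w = f u w + f v w" for u v w
      by (rule module_hom.add[OF Vector_Spaces.linear.axioms(3)[OF L]])
    show "f (scale c u) w = c * f u w" for c u w
      by (rule module_hom.scale[OF Vector_Spaces.linear.axioms(3)[OF L]])
  qed
qed

context symmetric_form
begin

text \<open>
  On the whole space the exponent of \<open>hermitian_zeros\<close> is \<open>form_rank\<close>, because a subspace of dimension
  \<open>m\<close> has \<open>q ^ m\<close> elements.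
\<close>

lemma rank_and_hermitian_zeros:
  assumes fin: "finite (UNIV :: 'v set)" and \<delta>: "anisotropic \<delta>"
  shows "form_rank scale f \<le> dim (UNIV :: 'v set)"
    and "card (radical f) = CARD('k) ^ (dim (UNIV :: 'v set) - form_rank scale f)"
    and "int CARD('k) * int (card {z. hermitian_ext \<delta> f z = 0}) = int CARD('v) ^ 2
      + (int CARD('k) - 1) * ((- 1) ^ form_rank scale f * int CARD('v) * int (card (radical f)))"
proof -
  have rad: "radical_on UNIV = radical f"
    by (simp add: radical_on_def radical_def)
  then have sub: "subspace (radical f)"
    using subspace_radical_on[of UNIV] by simp
  have card: "card (radical f) = CARD('k) ^ dim (radical f)" "CARD('v) = CARD('k) ^ dim (UNIV :: 'v set)"
    using card_subspace[OF sub finite_subset[OF subset_UNIV fin]] card_subspace[OF subspace_UNIV fin] .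
  obtain \<rho> where \<rho>: "CARD('v) = CARD('k) ^ \<rho> * card (radical f)"
    "int CARD('k) * int (card {z. hermitian_ext \<delta> f z = 0}) = int CARD('v) ^ 2
      + (int CARD('k) - 1) * ((- 1) ^ \<rho> * int CARD('v) * int (card (radical f)))"
    using hermitian_zeros[OF \<delta> subspace_UNIV fin, unfolded rad UNIV_Times_UNIV]
    by (elim exE conjE) (simp only: UNIV_I simp_thms)
  have "CARD('k) ^ dim (UNIV :: 'v set) = CARD('k) ^ (\<rho> + dim (radical f))"
    using \<rho>(1) card by (simp add: power_add)
  then have dim: "dim (UNIV :: 'v set) = \<rho> + dim (radical f)"
    by (simp only: power_inject_exp[OF field_order_gt_1])
  then have rank: "form_rank scale f = \<rho>" by (simp add: form_rank_def)
  show "form_rank scale f \<le> dim (UNIV :: 'v set)"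
    unfolding rank dim by simp
  show "card (radical f) = CARD('k) ^ (dim (UNIV :: 'v set) - form_rank scale f)"
    unfolding rank dim card(1) by simp
  show "int CARD('k) * int (card {z. hermitian_ext \<delta> f z = 0}) = int CARD('v) ^ 2
      + (int CARD('k) - 1) * ((- 1) ^ form_rank scale f * int CARD('v) * int (card (radical f)))"
    unfolding rank by (rule \<rho>(2))
qed

end

section \<open>Divisibility and the dimension bound\<close>

context finite_field_space
begin

text \<open>
  The Boolean \<open>e\<close> selects even or odd rank.  With \<open>w f = |V| |rad f|\<close>, the bilinear count shows that
  \<open>|M|\<close> divides the sum of \<open>w f\<close>, the Hermitian count that it divides the sum of \<open>(-1) ^ rank f * w f\<close>;
  the sum and the difference of the two give the factor 2.
\<close>

lemma card_dvd_parity_sum: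
  assumes fin: "finite (UNIV :: 'v set)"
    and M: "module.subspace form_scale M" "M \<subseteq> Symm scale"
  shows "int (card M) dvd
    2 * (\<Sum>f | f \<in> M \<and> even (form_rank scale f) = e. int CARD('v) * int (card (radical f)))"
proof -
  interpret F: finite_field_space "form_scale :: 'k \<Rightarrow> ('v \<Rightarrow> 'v \<Rightarrow> 'k) \<Rightarrow> _"
    by (simp add: finite_field_space_def vector_space_form_scale)
  obtain \<delta> :: 'k where \<delta>: "anisotropic \<delta>" using ex_anisotropic by blast
  have sf: "symmetric_form scale f" if "f \<in> M" for f
    using symmetric_form_Symm[OF vector_space_axioms subsetD[OF M(2) that]] .
  have finM: "finite M" by (rule finite_set_of_forms[OF fin])
  have finZ: "finite (UNIV :: ('v \<times> 'v) set)"
    using finite_cartesian_product[OF fin fin] by simp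
  let ?w = "\<lambda>f :: 'v \<Rightarrow> 'v \<Rightarrow> 'k. int CARD('v) * int (card (radical f))"
  let ?s = "\<lambda>f. (- 1 :: int) ^ form_rank scale f"
  have square: "int CARD('v \<times> 'v) = int CARD('v) ^ 2"
    by (simp add: card_prod power2_eq_square)
  have "int (card M) dvd (\<Sum>f\<in>M. ?w f)"
  proof (rule F.card_dvd_weight_sum[OF M(1) finM finZ])
    show "(f + g) (fst z) (snd z) = f (fst z) (snd z) + g (fst z) (snd z)"
      for f g and z :: "'v \<times> 'v" by simp
    show "form_scale c f (fst z) (snd z) = c * f (fst z) (snd z)"
      for c f and z :: "'v \<times> 'v" by (simp add: form_scale_def)
    show "int CARD('k) * int (card {z \<in> UNIV. f (fst z) (snd z) = 0})
        = int CARD('v \<times> 'v) + (int CARD('k) - 1) * ?w f" if "f \<in> M" for f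
      using symmetric_form.bilinear_zeros[OF sf[OF that] fin] unfolding square by simp
  qed
  moreover have "int (card M) dvd (\<Sum>f\<in>M. ?s f * ?w f)"
  proof (rule F.card_dvd_weight_sum[OF M(1) finM finZ])
    show "hermitian_ext \<delta> (f + g) z = hermitian_ext \<delta> f z + hermitian_ext \<delta> g z"
      for f g and z :: "'v \<times> 'v" by (simp add: hermitian_ext_def algebra_simps)
    show "hermitian_ext \<delta> (form_scale c f) z = c * hermitian_ext \<delta> f z"
      for c f and z :: "'v \<times> 'v" by (simp add: hermitian_ext_def form_scale_def algebra_simps)
    show "int CARD('k) * int (card {z \<in> UNIV. hermitian_ext \<delta> f z = 0})
        = int CARD('v \<times> 'v) + (int CARD('k) - 1) * (?s f * ?w f)" if "f \<in> M" for f
      using symmetric_form.rank_and_hermitian_zeros(3)[OF sf[OF that] fin \<delta>] unfolding square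
      by (simp add: mult.assoc)
  qed
  ultimately have "int (card M) dvd (\<Sum>f\<in>M. ?w f) + \<epsilon> * (\<Sum>f\<in>M. ?s f * ?w f)" for \<epsilon>
    by (rule dvd_add[OF _ dvd_mult])
  also have "(\<Sum>f\<in>M. ?w f) + \<epsilon> * (\<Sum>f\<in>M. ?s f * ?w f) = (\<Sum>f\<in>M. ?w f + \<epsilon> * (?s f * ?w f))" for \<epsilon>
    by (simp only: sum.distrib sum_distrib_left)
  finally have "int (card M) dvd (\<Sum>f\<in>M. ?w f + (if e then 1 else - 1) * (?s f * ?w f))" .
  also have "\<dots> = (\<Sum>f\<in>M. if even (form_rank scale f) = e then 2 * ?w f else 0)"
    by (rule sum.cong) auto
  also have "\<dots> = (\<Sum>f | f \<in> M \<and> even (form_rank scale f) = e. 2 * ?w f)"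
    by (rule sum.inter_filter[OF finM, symmetric])
  also have "\<dots> = 2 * (\<Sum>f | f \<in> M \<and> even (form_rank scale f) = e. ?w f)"
    by (simp only: sum_distrib_left)
  finally show ?thesis .
qed

text \<open>
  In the parity class of \<open>\<rho>\<close> only the rank \<open>\<rho>\<close> occurs, besides the zero form when \<open>\<rho>\<close> is even.  The zero
  form contributes \<open>q ^ (2n)\<close>, which is divisible by \<open>q ^ (2n - r + 1)\<close> because \<open>r > 0\<close>; so the
  contribution \<open>2 A q ^ (2n - \<rho>)\<close> of the others is too, and \<open>\<rho> \<ge> r\<close> allows the power to be cancelled.
\<close>

lemma field_order_dvd_twice_card_rank:
  assumes fin: "finite (UNIV :: 'v set)"
    and M: "module.subspace form_scale M" "M \<subseteq> Symm scale"
    and r: "0 < r" "r \<le> \<rho>" "\<rho> \<le> dim (UNIV :: 'v set)"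
    and only: "\<And>f. f \<in> M \<Longrightarrow> f \<noteq> 0 \<Longrightarrow> even (form_rank scale f) = even \<rho>
      \<Longrightarrow> form_rank scale f = \<rho>"
    and big: "CARD('k) ^ (2 * dim (UNIV :: 'v set) - r + 1) dvd card M"
  shows "CARD('k) dvd 2 * card {f \<in> M. f \<noteq> 0 \<and> form_rank scale f = \<rho>}"
proof -
  interpret F: finite_field_space "form_scale :: 'k \<Rightarrow> ('v \<Rightarrow> 'v \<Rightarrow> 'k) \<Rightarrow> _"
    by (simp add: finite_field_space_def vector_space_form_scale)
  let ?n = "dim (UNIV :: 'v set)" and ?q = "int CARD('k)"
  let ?A = "{f \<in> M. f \<noteq> 0 \<and> form_rank scale f = \<rho>}"
  let ?w = "\<lambda>f :: 'v \<Rightarrow> 'v \<Rightarrow> 'k. int CARD('v) * int (card (radical f))"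
  obtain \<delta> :: 'k where \<delta>: "anisotropic \<delta>" using ex_anisotropic by blast
  have sf: "symmetric_form scale f" if "f \<in> M" for f
    using symmetric_form_Symm[OF vector_space_axioms subsetD[OF M(2) that]] .
  have finM: "finite M" by (rule finite_set_of_forms[OF fin])
  have V: "CARD('v) = CARD('k) ^ ?n"
    using card_subspace[OF subspace_UNIV fin] .
  have w: "?w f = ?q ^ (2 * ?n - form_rank scale f)" if "f \<in> M" for f
  proof -
    have "form_rank scale f \<le> ?n" "card (radical f) = CARD('k) ^ (?n - form_rank scale f)"
      using symmetric_form.rank_and_hermitian_zeros(1,2)[OF sf[OF that] fin \<delta>] .
    moreover from this(1) have "2 * ?n - form_rank scale f = ?n + (?n - form_rank scale f)"
      by linarith
    ultimately show ?thesis by (simp only: V of_nat_power power_add)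
  qed
  have zero: "0 \<in> M"
    using F.subspace_0[OF M(1)] .
  have "radical (0 :: 'v \<Rightarrow> 'v \<Rightarrow> 'k) = UNIV" by (simp add: radical_def)
  then have rank0: "form_rank scale (0 :: 'v \<Rightarrow> 'v \<Rightarrow> 'k) = 0" by (simp add: form_rank_def)
  have "{f \<in> M. even (form_rank scale f) = even \<rho>} = ?A \<union> (if even \<rho> then {0} else {})"
  proof (rule set_eqI)
    fix f
    have "even (form_rank scale f) = even \<rho> \<longleftrightarrow> form_rank scale f = \<rho>" if "f \<in> M" "f \<noteq> 0"
      using only[OF that] by blast
    then show "f \<in> {f \<in> M. even (form_rank scale f) = even \<rho>}
        \<longleftrightarrow> f \<in> ?A \<union> (if even \<rho> then {0} else {})"
      using zero rank0 by (cases "f = 0") auto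
  qed
  then have "(\<Sum>f | f \<in> M \<and> even (form_rank scale f) = even \<rho>. ?w f)
      = (\<Sum>f\<in>?A \<union> (if even \<rho> then {0} else {}). ?w f)"
    by (simp only:)
  also have "\<dots> = (\<Sum>f\<in>?A. ?w f) + (\<Sum>f\<in>(if even \<rho> then {0} else {}). ?w f)"
    by (rule sum.union_disjoint) (use finM in \<open>auto split: if_splits\<close>)
  finally have sum: "(\<Sum>f | f \<in> M \<and> even (form_rank scale f) = even \<rho>. ?w f)
      = (\<Sum>f\<in>?A. ?w f) + (\<Sum>f\<in>(if even \<rho> then {0} else {}). ?w f)" .
  have "(\<Sum>f\<in>?A. ?w f) = int (card ?A) * ?q ^ (2 * ?n - \<rho>)"
  proof -
    have "(\<Sum>f\<in>?A. ?w f) = (\<Sum>f\<in>?A. ?q ^ (2 * ?n - \<rho>))"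
    proof (rule sum.cong[OF refl])
      fix f assume "f \<in> ?A"
      then show "?w f = ?q ^ (2 * ?n - \<rho>)" using w[of f] by simp
    qed
    then show ?thesis by simp
  qed
  moreover have "?q ^ (2 * ?n - r + 1) dvd 2 * (\<Sum>f\<in>(if even \<rho> then {0} else {}). ?w f)"
  proof (rule dvd_mult)
    have "?q ^ (2 * ?n - r + 1) dvd ?w 0"
      unfolding w[OF zero] rank0 using r by (intro le_imp_power_dvd) linarith
    then show "?q ^ (2 * ?n - r + 1) dvd (\<Sum>f\<in>(if even \<rho> then {0} else {}). ?w f)"
      by simp
  qed
  moreover have "?q ^ (2 * ?n - r + 1) dvd 2 * (\<Sum>f | f \<in> M \<and> even (form_rank scale f) = even \<rho>. ?w f)"
  proof (rule dvd_trans)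
    show "?q ^ (2 * ?n - r + 1) dvd int (card M)"
      using big unfolding of_nat_power[symmetric] of_nat_dvd_iff .
  qed (rule card_dvd_parity_sum[OF fin M])
  ultimately have "?q ^ (2 * ?n - r + 1) dvd 2 * (int (card ?A) * ?q ^ (2 * ?n - \<rho>))"
    unfolding sum by (simp only: distrib_left dvd_add_left_iff)
  also have "\<dots> dvd 2 * (int (card ?A) * ?q ^ (2 * ?n - r))"
    using r by (intro mult_dvd_mono le_imp_power_dvd) auto
  finally have "?q ^ (2 * ?n - r) * ?q dvd ?q ^ (2 * ?n - r) * (2 * int (card ?A))"
    by (simp add: mult_ac)
  then have "?q dvd int (2 * card ?A)" by simp
  then show ?thesis unfolding of_nat_dvd_iff .
qed

end

theorem theorem10:
  fixes scale :: "'k::{field,finite} \<Rightarrow> 'v::ab_group_add \<Rightarrow> 'v"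
    and Basis :: "'v set"
    and M :: "('v \<Rightarrow> 'v \<Rightarrow> 'k) set"
    and q n r l :: nat
  assumes "q = CARD('k)"
    and "finite_dimensional_vector_space scale Basis"
    and "vector_space.dim scale (UNIV :: 'v set) = n"
    and "n \<ge> 2"
    and "module.subspace form_scale M"
    and "M \<subseteq> Symm scale"
    and "odd r \<longleftrightarrow> even l"
    and "0 < r" and "r < l" and "l \<le> n"
    and "\<And>f. f \<in> M \<Longrightarrow> f \<noteq> 0 \<Longrightarrow> form_rank scale f = r \<or> form_rank scale f = l"
    and "q \<noteq> 2"
  shows "vector_space.dim form_scale M \<le> 2 * n - r"
proof (rule ccontr)
  interpret V: finite_dimensional_vector_space scale Basis by (fact assms)
  interpret V: finite_field_space scale
    by (simp add: finite_field_space_def V.vector_space_axioms)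
  interpret F: finite_field_space "form_scale :: 'k \<Rightarrow> ('v \<Rightarrow> 'v \<Rightarrow> 'k) \<Rightarrow> _"
    by (simp add: finite_field_space_def vector_space_form_scale)
  assume "\<not> ?thesis"
  then have d: "2 * n - r + 1 \<le> F.dim M" by simp
  have fin: "finite (UNIV :: 'v set)"
    using V.card_span_independent[OF V.finite_Basis V.independent_Basis] V.span_Basis by simp
  have finM: "finite M" by (rule finite_set_of_forms[OF fin])
  have cardM: "card M = q ^ F.dim M"
    using F.card_subspace[OF assms(5) finM] assms(1) by simp
  let ?A = "\<lambda>\<rho>. {f \<in> M. f \<noteq> 0 \<and> form_rank scale f = \<rho>}"
  have dvd: "q dvd 2 * card (?A \<rho>)" if "\<rho> = r \<or> \<rho> = l" for \<rho>
    unfolding assms(1)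
  proof (rule V.field_order_dvd_twice_card_rank[OF fin assms(5,6) assms(8)])
    show "r \<le> \<rho>" "\<rho> \<le> V.dim UNIV" using assms(3,9,10) that by auto
    show "form_rank scale f = \<rho>"
      if "f \<in> M" "f \<noteq> 0" "even (form_rank scale f) = even \<rho>" for f
      using assms(7) assms(11)[OF that(1,2)] that(3) \<open>\<rho> = r \<or> \<rho> = l\<close> by metis
    show "CARD('k) ^ (2 * V.dim UNIV - r + 1) dvd card M"
      unfolding cardM assms(3) assms(1)[symmetric] using d by (rule le_imp_power_dvd)
  qed
  have "0 \<in> M" using F.subspace_0[OF assms(5)] .
  moreover have "M - {0} = ?A r \<union> ?A l" using assms(11) by blast
  moreover have "card (?A r \<union> ?A l) = card (?A r) + card (?A l)"
    using finM \<open>r < l\<close> by (intro card_Un_disjoint) auto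
  ultimately have "card M = 1 + (card (?A r) + card (?A l))"
    using card.remove[OF finM, of 0] by simp
  then have "2 * card M = 2 + (2 * card (?A r) + 2 * card (?A l))" by simp
  moreover have "q dvd 2 * card M"
    unfolding cardM using d by (intro dvd_mult dvd_power) simp
  ultimately have "q dvd 2 + (2 * card (?A r) + 2 * card (?A l))" by (simp only:)
  moreover have "q dvd 2 * card (?A r) + 2 * card (?A l)"
    by (intro dvd_add dvd) simp_all
  ultimately have "q dvd 2" by (simp only: dvd_add_left_iff)
  then have "q \<le> 2" by (simp add: dvd_imp_le)
  moreover have "q > 1" unfolding assms(1) by (rule field_order_gt_1)
  ultimately show False using \<open>q \<noteq> 2\<close> by simp
qed

end
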